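(* Suppose that $\varphi$ is an analytic self-map of the unit disk $D$, $0<p<\infty$, and that the composition operator $C_\varphi : A^p\to\mathcal{B}$ is bounded. Then $C_\varphi : A^p\to\mathcal{B}$ is compact if and only if $$\lim_{|\varphi(z)|\to1}\frac{(1-|z|^2)|\varphi'(z)|}{(1-|\varphi(z)|^2)^{1+2/p}}=0.$$
   Context: $D$ is the open unit disk in $\mathbb{C}$ and $H(D)$ is the class of all analytic functions on $D$. An analytic self-map of $D$ is an analytic function $\varphi:D\to D$; it induces the composition operator $C_\varphi f=f\circ\varphi$, $f\in H(D)$. For $0<p<\infty$, the Bergman space $A^p$ is the space of $f\in H(D)$ with $\int_D|f(z)|^p\,dA(z)<\infty$, where $dA$ is the normalized Lebesgue area measure on $D$ ($A(D)=1$), with the usual norm (quasinorm if $p<1$) $\left(\int_D|f|^p\,dA\right)^{1/p}$. The Bloch space $\mathcal{B}$ is the space of $f\in H(D)$ with $B(f)=\sup_{z\in D}(1-|z|^2)|f'(z)|<\infty$, normed by $\|f\|_{\mathcal{B}}=|f(0)|+B(f)$. A linear operator is bounded if it maps the first space into the second and the image of every bounded set is bounded; it is compact if it takes bounded sets to sets with compact closure. $\lim_{|\varphi(z)|\to1}F(z)=0$ means: for every $\varepsilon>0$ there is $\delta\in(0,1)$ such that $|F(z)|<\varepsilon$ for all $z\in D$ with $\delta<|\varphi(z)|<1$; it holds automatically if no sequence $(z_n)$ in $D$ satisfies $|\varphi(z_n)|\to1$. *)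

theory Defs
  imports "HOL-Complex_Analysis.Complex_Analysis"
begin

abbreviation unit_disc :: "complex set" where
  "unit_disc \<equiv> ball 0 1"

(* Functions on the disc are represented by total functions that vanish off the disc, so that
   equality of elements of H(D) is equality in HOL and pointwise subtraction stays in the space. *)
definition analytic_disc :: "(complex \<Rightarrow> complex) set" where
  "analytic_disc = {f. f analytic_on unit_disc \<and> (\<forall>z. z \<notin> unit_disc \<longrightarrow> f z = 0)}"

definition analytic_self_map :: "(complex \<Rightarrow> complex) \<Rightarrow> bool" where
  "analytic_self_map \<phi> \<longleftrightarrow> \<phi> analytic_on unit_disc \<and> \<phi> ` unit_disc \<subseteq> unit_disc"

definition comp_op :: "(complex \<Rightarrow> complex) \<Rightarrow> (complex \<Rightarrow> complex) \<Rightarrow> complex \<Rightarrow> complex" where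
  "comp_op \<phi> f = (\<lambda>z. if z \<in> unit_disc then f (\<phi> z) else 0)"


definition disc_area :: "complex measure" where
  "disc_area = uniform_measure lborel unit_disc"

definition bergman :: "real \<Rightarrow> (complex \<Rightarrow> complex) set" where
  "bergman p = {f \<in> analytic_disc. integrable disc_area (\<lambda>z. norm (f z) powr p)}"

definition bergman_norm :: "real \<Rightarrow> (complex \<Rightarrow> complex) \<Rightarrow> real" where
  "bergman_norm p f = (LINT z|disc_area. norm (f z) powr p) powr (1 / p)"


definition bloch :: "(complex \<Rightarrow> complex) set" where
  "bloch = {f \<in> analytic_disc.
     bdd_above ((\<lambda>z. (1 - (norm z)\<^sup>2) * norm (deriv f z)) ` unit_disc)}"

definition bloch_seminorm :: "(complex \<Rightarrow> complex) \<Rightarrow> real" where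
  "bloch_seminorm f = (SUP z\<in>unit_disc. (1 - (norm z)\<^sup>2) * norm (deriv f z))"

definition bloch_norm :: "(complex \<Rightarrow> complex) \<Rightarrow> real" where
  "bloch_norm f = norm (f 0) + bloch_seminorm f"

(* The case distinction is irrelevant on the space itself; the locale Metric_space asks for
   nonnegativity and symmetry also off the carrier. *)
definition bloch_dist :: "(complex \<Rightarrow> complex) \<Rightarrow> (complex \<Rightarrow> complex) \<Rightarrow> real" where
  "bloch_dist f g =
     (if f \<in> bloch \<and> g \<in> bloch then bloch_norm (\<lambda>z. f z - g z) else 0)"

definition bloch_topology :: "(complex \<Rightarrow> complex) topology" where
  "bloch_topology = Metric_space.mtopology bloch bloch_dist"


definition norm_bounded :: "'a set \<Rightarrow> ('a \<Rightarrow> real) \<Rightarrow> 'a set \<Rightarrow> bool" where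
  "norm_bounded X N S \<longleftrightarrow> S \<subseteq> X \<and> (\<exists>M. \<forall>f\<in>S. N f \<le> M)"

definition bounded_operator ::
    "'a set \<Rightarrow> ('a \<Rightarrow> real) \<Rightarrow> 'b set \<Rightarrow> ('b \<Rightarrow> real) \<Rightarrow> ('a \<Rightarrow> 'b) \<Rightarrow> bool" where
  "bounded_operator X N Y N' T \<longleftrightarrow>
     T ` X \<subseteq> Y \<and> (\<forall>S. norm_bounded X N S \<longrightarrow> norm_bounded Y N' (T ` S))"

(* The inclusion is explicit because closure_of ignores points outside the topology's carrier. *)
definition compact_operator ::
    "'a set \<Rightarrow> ('a \<Rightarrow> real) \<Rightarrow> 'b topology \<Rightarrow> ('a \<Rightarrow> 'b) \<Rightarrow> bool" where
  "compact_operator X N \<tau> T \<longleftrightarrow>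
     (\<forall>S. norm_bounded X N S \<longrightarrow>
        T ` S \<subseteq> topspace \<tau> \<and> compactin \<tau> (\<tau> closure_of (T ` S)))"

(* lim F(z) = 0 as |phi(z)| -> 1 (vacuous if |phi| stays away from 1 on the disc) *)
definition vanishes_at_boundary_values ::
    "(complex \<Rightarrow> complex) \<Rightarrow> (complex \<Rightarrow> real) \<Rightarrow> bool" where
  "vanishes_at_boundary_values \<phi> F \<longleftrightarrow>
     (\<forall>\<epsilon>>0. \<exists>\<delta>. 0 < \<delta> \<and> \<delta> < 1 \<and>
        (\<forall>z\<in>unit_disc. \<delta> < norm (\<phi> z) \<and> norm (\<phi> z) < 1 \<longrightarrow> \<bar>F z\<bar> < \<epsilon>))"


lemma unit_disc_weight_nonneg: "z \<in> unit_disc \<Longrightarrow> 0 \<le> 1 - (norm z)\<^sup>2"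
  by (simp add: abs_square_le_1)

lemma bloch_differentiable:
  assumes "f \<in> bloch" "z \<in> unit_disc"
  shows "f field_differentiable at z"
  using assms analytic_on_imp_differentiable_at unfolding bloch_def analytic_disc_def by blast

lemma bloch_weight_le:
  assumes "f \<in> bloch" "z \<in> unit_disc"
  shows "(1 - (norm z)\<^sup>2) * norm (deriv f z) \<le> bloch_seminorm f"
  using assms unfolding bloch_def bloch_seminorm_def by (auto intro: cSUP_upper)

lemma bloch_seminorm_nonneg: "f \<in> bloch \<Longrightarrow> 0 \<le> bloch_seminorm f"
  using bloch_weight_le[of f 0] by (force intro: order_trans[of 0 "norm (deriv f 0)"])

lemma bloch_norm_nonneg: "f \<in> bloch \<Longrightarrow> 0 \<le> bloch_norm f"
  by (simp add: bloch_norm_def bloch_seminorm_nonneg)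

lemma bloch_diff_weight:
  assumes "f \<in> bloch" "g \<in> bloch" "z \<in> unit_disc"
  shows "(1 - (norm z)\<^sup>2) * norm (deriv (\<lambda>z. f z - g z) z)
           \<le> bloch_seminorm f + bloch_seminorm g"
proof -
  have "deriv (\<lambda>z. f z - g z) z = deriv f z - deriv g z"
    using assms by (intro deriv_diff bloch_differentiable)
  then have "(1 - (norm z)\<^sup>2) * norm (deriv (\<lambda>z. f z - g z) z)
      \<le> (1 - (norm z)\<^sup>2) * (norm (deriv f z) + norm (deriv g z))"
    using unit_disc_weight_nonneg[OF assms(3)] norm_triangle_ineq4
    by (auto intro!: mult_left_mono)
  then show ?thesis
    using bloch_weight_le[OF assms(1,3)] bloch_weight_le[OF assms(2,3)]
    by (simp add: distrib_left)
qed

lemma bloch_diff: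
  assumes "f \<in> bloch" "g \<in> bloch"
  shows "(\<lambda>z. f z - g z) \<in> bloch"
proof -
  have "(\<lambda>z. f z - g z) analytic_on unit_disc"
    using assms unfolding bloch_def analytic_disc_def by (auto intro: analytic_on_diff)
  moreover have "bdd_above ((\<lambda>z. (1 - (norm z)\<^sup>2) * norm (deriv (\<lambda>z. f z - g z) z)) ` unit_disc)"
    using bloch_diff_weight[OF assms] by (rule bdd_aboveI2)
  ultimately show ?thesis
    using assms by (auto simp: bloch_def analytic_disc_def)
qed

lemma bloch_norm_diff_le:
  assumes "f \<in> bloch" "g \<in> bloch"
  shows "bloch_norm (\<lambda>z. f z - g z) \<le> bloch_norm f + bloch_norm g"
proof -
  have "bloch_seminorm (\<lambda>z. f z - g z) \<le> bloch_seminorm f + bloch_seminorm g"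
    unfolding bloch_seminorm_def[of "\<lambda>z. f z - g z"]
    using bloch_diff_weight[OF assms] by (intro cSUP_least) auto
  then show ?thesis
    using norm_triangle_ineq4[of "f 0" "g 0"] by (simp add: bloch_norm_def)
qed

lemma zero_in_bloch: "(\<lambda>z. 0) \<in> bloch"
  by (auto simp: bloch_def analytic_disc_def)

lemma bloch_norm_zero: "bloch_norm (\<lambda>z. 0) = 0"
  by (simp add: bloch_norm_def bloch_seminorm_def)

lemma bloch_norm_eq_0D:
  assumes "f \<in> bloch" "bloch_norm f = 0"
  shows "f = (\<lambda>z. 0)"
proof -
  have f0: "f 0 = 0" and B: "bloch_seminorm f = 0"
    using assms bloch_seminorm_nonneg[OF assms(1)]
    by (simp_all add: bloch_norm_def add_nonneg_eq_0_iff)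
  have "f z = 0" if z: "z \<in> unit_disc" for z
  proof -
    have "(f has_field_derivative 0) (at w within unit_disc)" if w: "w \<in> unit_disc" for w
    proof -
      have "(norm w)\<^sup>2 < 1" using w by (simp add: power_less_one_iff)
      moreover have "(1 - (norm w)\<^sup>2) * norm (deriv f w) \<le> 0"
        using bloch_weight_le[OF assms(1) w] B by simp
      ultimately have "deriv f w = 0"
        by (simp add: mult_le_0_iff)
      then show ?thesis
        using bloch_differentiable[OF assms(1) w]
        by (metis DERIV_deriv_iff_field_differentiable has_field_derivative_at_within)
    qed
    then obtain c where "\<And>w. w \<in> unit_disc \<Longrightarrow> f w = c"
      using has_field_derivative_zero_constant[OF convex_ball] by blast
    then show ?thesis using z f0 by (metis centre_in_ball zero_less_one)
  qed
  then show ?thesis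
    using assms(1) by (auto simp: bloch_def analytic_disc_def)
qed

lemma bloch_metric_space: "Metric_space bloch bloch_dist"
proof
  show "0 \<le> bloch_dist f g" for f g
    by (simp add: bloch_dist_def bloch_norm_nonneg bloch_diff)
  have sym: "bloch_norm (\<lambda>z. f z - g z) \<le> bloch_norm (\<lambda>z. g z - f z)"
    if "f \<in> bloch" "g \<in> bloch" for f g
    using bloch_norm_diff_le[OF zero_in_bloch bloch_diff[OF that(2,1)]]
    by (simp add: bloch_norm_zero)
  then show "bloch_dist f g = bloch_dist g f" for f g
    by (auto simp: bloch_dist_def intro: antisym)
  show "bloch_dist f g = 0 \<longleftrightarrow> f = g" if "f \<in> bloch" "g \<in> bloch" for f g
  proof
    assume "bloch_dist f g = 0"
    then have "(\<lambda>z. f z - g z) = (\<lambda>z. 0)"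
      using that bloch_norm_eq_0D[OF bloch_diff[OF that]] by (simp add: bloch_dist_def)
    then show "f = g" by (metis eq_iff_diff_eq_0 ext)
  next
    assume "f = g"
    then show "bloch_dist f g = 0" by (simp add: bloch_dist_def bloch_norm_zero)
  qed
  show "bloch_dist f h \<le> bloch_dist f g + bloch_dist g h"
    if "f \<in> bloch" "g \<in> bloch" "h \<in> bloch" for f g h
    using bloch_norm_diff_le[OF bloch_diff[OF that(1,2)] bloch_diff[OF that(3,2)]]
      sym[OF that(3,2)] that
    by (simp add: bloch_dist_def)
qed

lemma topspace_bloch_topology: "topspace bloch_topology = bloch"
  unfolding bloch_topology_def
  by (rule Metric_space.topspace_mtopology[OF bloch_metric_space])

end

theory Submission
  imports Defs
begin

text \<open>
The derivative of \<open>f \<circ> \<phi>\<close> at \<open>z\<close> is \<open>deriv f (\<phi> z) * deriv \<phi> z\<close>, and the largest order of growth of \<open>deriv f w\<close>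
for \<open>f\<close> in the unit ball of \<open>A\<^sup>p\<close> is \<open>(1 - (norm w)\<^sup>2) powr - (1 + 2 / p)\<close>. The quotient in the criterion
thus measures how much of the Bloch norm of \<open>f \<circ> \<phi>\<close> can be produced near points where \<open>\<phi>\<close> approaches the
circle; compactness means that this part is negligible.

For sufficiency, the growth estimate \<open>bergman_growth\<close> makes a bounded sequence in \<open>A\<^sup>p\<close> a normal family,
and Montel's theorem gives a locally uniformly convergent subsequence. The composites converge in the
Bloch norm (\<open>composite_weight_uniformly_small\<close>): where \<open>\<phi> z\<close> stays in a smaller disc, by locally uniform
convergence of derivatives; elsewhere, by the growth of derivatives and the boundary condition.

For necessity, the functions \<open>bergman_test p k a\<close> realise, up to a constant, the extremal growth of
the derivative at \<open>a\<close>, are bounded in \<open>A\<^sup>p\<close>, and tend to zero pointwise with their derivatives as \<open>norm a\<close> tends to 1.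
Compactness makes their images null in the Bloch norm along a subsequence, and evaluating the weighted
derivatives at points \<open>z\<close> with \<open>\<phi> z = a\<close> yields the boundary condition. The bound on their norms
(\<open>nn_integral_kernel_le\<close>) comes from a dyadic decomposition of the disc into shells about the
reflected point \<open>1 / cnj a\<close>.
\<close>

section \<open>Cauchy's estimate and area on the disc\<close>

lemma norm_le_add_dist: "norm w \<le> norm z + dist z w"
  using norm_triangle_sub[of w z] by (simp add: dist_norm norm_minus_commute)

lemma norm_deriv_le_Cauchy:
  assumes "f analytic_on cball z r" "0 < r" "\<And>w. w \<in> cball z r \<Longrightarrow> norm (f w) \<le> B"
  shows "norm (deriv f z) \<le> B / r"
proof -
  have "f holomorphic_on cball z r"
    using assms(1) by (rule analytic_imp_holomorphic)
  then have "norm ((deriv ^^ 1) f z) \<le> fact 1 * B / r ^ 1"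
    using assms by (intro Cauchy_inequality)
      (auto intro: holomorphic_on_subset holomorphic_on_imp_continuous_on simp: dist_norm)
  then show ?thesis by simp
qed

lemma sets_disc_area [simp, measurable_cong]: "sets disc_area = sets borel"
  by (simp add: disc_area_def)

lemma space_disc_area [simp]: "space disc_area = UNIV"
  by (simp add: disc_area_def)

lemma emeasure_ball_complex:
  "0 \<le> r \<Longrightarrow> emeasure lborel (ball (z :: complex) r) = ennreal (pi * r\<^sup>2)"
  by (simp add: emeasure_ball unit_ball_vol_2)

lemma emeasure_disc_area:
  "B \<in> sets borel \<Longrightarrow> emeasure disc_area B = emeasure lborel (unit_disc \<inter> B) / ennreal pi"
  using emeasure_ball_complex[of 1 0] by (simp add: disc_area_def)

lemma emeasure_disc_area_ball_le:
  assumes "0 \<le> r"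
  shows "emeasure disc_area (ball z r) \<le> ennreal (r\<^sup>2)"
proof -
  have "emeasure disc_area (ball z r) = emeasure lborel (unit_disc \<inter> ball z r) / ennreal pi"
    by (simp add: emeasure_disc_area)
  also have "\<dots> \<le> ennreal (pi * r\<^sup>2) / ennreal pi"
    unfolding emeasure_ball_complex[OF assms, of z, symmetric]
    by (intro divide_right_mono_ennreal emeasure_mono) auto
  also have "\<dots> = ennreal (r\<^sup>2)"
    by (simp add: divide_ennreal)
  finally show ?thesis .
qed

lemma measure_disc_area_ball:
  assumes "0 \<le> r" "ball z r \<subseteq> unit_disc"
  shows "measure disc_area (ball z r) = r\<^sup>2"
proof -
  have "unit_disc \<inter> ball z r = ball z r" using assms(2) by blast
  then have "emeasure disc_area (ball z r) = ennreal (r\<^sup>2)"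
    by (simp add: emeasure_disc_area emeasure_ball_complex assms(1) divide_ennreal)
  then show ?thesis by (simp add: measure_def)
qed


section \<open>Growth of Bergman functions and their derivatives\<close>

lemma bergman_analytic: "f \<in> bergman p \<Longrightarrow> f analytic_on unit_disc"
  by (simp add: bergman_def analytic_disc_def)

lemma bergman_norm_nonneg: "0 \<le> bergman_norm p f"
  by (simp add: bergman_norm_def)

lemma bergman_norm_ge_ball:
  assumes f: "f \<in> bergman p" and p: "0 < p" and r: "0 \<le> r" "ball z r \<subseteq> unit_disc"
    and c: "0 \<le> c" "\<And>w. w \<in> ball z r \<Longrightarrow> c \<le> norm (f w)"
  shows "c * r powr (2 / p) \<le> bergman_norm p f"
proof -
  have int: "integrable disc_area (\<lambda>w. norm (f w) powr p)"
    using f by (simp add: bergman_def)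
  have "finite_measure disc_area"
    using emeasure_ball_complex[of 1 0]
    by (intro finite_measureI) (simp add: emeasure_disc_area ennreal_divide_eq_top_iff)
  then interpret finite_measure disc_area .
  have "c powr p * r\<^sup>2 = (LINT w|disc_area. c powr p * indicat_real (ball z r) w)"
    using measure_disc_area_ball[OF r] by simp
  also have "\<dots> \<le> (LINT w|disc_area. norm (f w) powr p)"
  proof (rule integral_mono[OF _ int])
    show "integrable disc_area (\<lambda>w. c powr p * indicat_real (ball z r) w)"
      by (intro integrable_mult_right integrable_real_indicator) (auto simp: less_top[symmetric])
    show "c powr p * indicat_real (ball z r) w \<le> norm (f w) powr p" for w
      using c p by (auto simp: indicator_def intro: powr_mono2)
  qed
  finally have "(c powr p * r\<^sup>2) powr (1 / p) \<le> bergman_norm p f"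
    unfolding bergman_norm_def using p by (intro powr_mono2) auto
  moreover have "(c powr p * r\<^sup>2) powr (1 / p) = c * r powr (2 / p)"
    using c(1) r(1) p
    by (cases "r = 0") (auto simp: powr_mult powr_powr simp flip: powr_numeral)
  ultimately show ?thesis by simp
qed

text \<open>
At a point \<open>z\<close> that maximises \<open>norm (f z) * (\<rho> - norm z) powr s\<close>, the values of \<open>f\<close> on the disc of
radius \<open>(\<rho> - norm z) / 2\<close> exceed \<open>norm (f z)\<close> by at most the factor \<open>2 powr s\<close>. Cauchy's estimate
turns this into a bound for the derivative, so that \<open>f\<close> cannot lose half of its modulus on a
concentric disc whose radius is a fixed proportion of \<open>\<rho> - norm z\<close>.
\<close>

lemma norm_ge_half_near_weighted_max:
  assumes f: "f analytic_on unit_disc" and \<rho>: "\<rho> < 1" and z: "norm z < \<rho>" and s: "0 \<le> s"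
    and max: "\<And>w. norm w < \<rho> \<Longrightarrow>
                norm (f w) * (\<rho> - norm w) powr s \<le> norm (f z) * (\<rho> - norm z) powr s"
    and w: "dist z w \<le> (\<rho> - norm z) / (8 * 2 powr s)"
  shows "norm (f z) / 2 \<le> norm (f w)"
proof -
  define d where "d = \<rho> - norm z"
  define L where "L = (2::real) powr s"
  have d: "d > 0" using z by (simp add: d_def)
  have L: "L \<ge> 1" using s by (simp add: L_def ge_one_powr_ge_zero)
  have fL: "norm (f u) \<le> L * norm (f z)" if "dist z u \<le> d / 2" for u
  proof -
    have "norm u \<le> norm z + dist z u" by (rule norm_le_add_dist)
    then have du: "d / 2 \<le> \<rho> - norm u" using that by (simp add: d_def field_simps)
    then have "norm (f u) * (d / 2) powr s \<le> norm (f u) * (\<rho> - norm u) powr s"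
      using d s by (intro mult_left_mono powr_mono2) auto
    also have "\<dots> \<le> norm (f z) * d powr s"
      using max[of u] du d by (simp add: d_def)
    finally show ?thesis
      using d by (simp add: powr_divide L_def field_simps)
  qed
  have disc: "u \<in> unit_disc" if "dist z u \<le> d / 2" for u
  proof -
    have "norm u \<le> norm z + dist z u" by (rule norm_le_add_dist)
    then show ?thesis using that \<rho> d by (simp add: d_def field_simps)
  qed
  have deriv: "norm (deriv f u) \<le> L * norm (f z) / (d / 4)" if u: "u \<in> cball z (d / 4)" for u
  proof (rule norm_deriv_le_Cauchy)
    have *: "dist z v \<le> d / 2" if "v \<in> cball u (d / 4)" for v
      using u that dist_triangle[of z v u] by simp
    show "f analytic_on cball u (d / 4)"
      using f by (rule analytic_on_subset) (use * disc in blast)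
    show "norm (f v) \<le> L * norm (f z)" if "v \<in> cball u (d / 4)" for v
      using fL[OF *[OF that]] .
  qed (use d in auto)
  have wd: "dist z w \<le> d / (8 * L)" using w by (simp add: d_def L_def)
  also have "\<dots> \<le> d / 4" using d L by (intro divide_left_mono) auto
  finally have "w \<in> cball z (d / 4)" by simp
  then have "norm (f z - f w) \<le> L * norm (f z) / (d / 4) * norm (z - w)"
  proof (intro field_differentiable_bound[OF convex_cball[of z "d / 4"], where f' = "deriv f"] deriv)
    fix u assume "u \<in> cball z (d / 4)"
    then have "u \<in> unit_disc" using disc[of u] d by simp
    then show "(f has_field_derivative deriv f u) (at u within cball z (d / 4))"
      using analytic_on_imp_differentiable_at[OF f]
      by (simp add: DERIV_deriv_iff_field_differentiable has_field_derivative_at_within)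
  qed (use d in auto)
  also have "\<dots> \<le> L * norm (f z) / (d / 4) * (d / (8 * L))"
    using wd L d by (intro mult_left_mono) (auto simp: dist_norm)
  also have "\<dots> = norm (f z) / 2" using d L by simp
  finally show ?thesis
    using norm_triangle_ineq2[of "f z" "f w"] by linarith
qed

text \<open>
At a maximum of the weighted modulus, \<open>f\<close> keeps half of its size on a disc of comparable radius, and
the integral over that disc bounds the norm from below. This covers all \<open>p > 0\<close> at once, without
subharmonicity of \<open>norm (f z) powr p\<close>.
\<close>

lemma bergman_growth:
  assumes p: "0 < p"
  obtains C where "0 < C"
    "\<And>f z. f \<in> bergman p \<Longrightarrow> z \<in> unit_disc \<Longrightarrow>
       norm (f z) * (1 - norm z) powr (2 / p) \<le> C * bergman_norm p f"
proof
  define s where "s = 2 / p"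
  define D where "D = 2 * (8 * 2 powr s) powr s"
  have s: "s > 0" using p by (simp add: s_def)
  show "0 < 2 powr s * D" by (simp add: D_def)
  fix f a assume f: "f \<in> bergman p" and a: "a \<in> unit_disc"
  \<comment> \<open>Shrinking the disc makes the weighted modulus continuous on a compact set; the factor lost is \<open>2 powr s\<close>.\<close>
  define \<rho> where "\<rho> = (1 + norm a) / 2"
  have \<rho>: "\<rho> < 1" "norm a < \<rho>" using a by (auto simp: \<rho>_def)
  have "continuous_on (cball 0 \<rho>) f"
    using bergman_analytic[OF f] \<rho>
    by (auto intro!: holomorphic_on_imp_continuous_on analytic_imp_holomorphic
        elim!: analytic_on_subset)
  moreover have "continuous_on (cball 0 \<rho>) (\<lambda>w. (\<rho> - norm w) powr s)"
    by (rule continuous_on_powr') (use s in \<open>auto intro!: continuous_intros\<close>)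
  ultimately have cont: "continuous_on (cball 0 \<rho>) (\<lambda>w. norm (f w) * (\<rho> - norm w) powr s)"
    by (intro continuous_on_mult continuous_on_norm)
  have "cball (0 :: complex) \<rho> \<noteq> {}" using \<rho>(2) norm_ge_zero[of a] by (simp del: norm_ge_zero)
  then obtain z where "z \<in> cball 0 \<rho>"
    and "\<forall>w\<in>cball 0 \<rho>. norm (f w) * (\<rho> - norm w) powr s \<le> norm (f z) * (\<rho> - norm z) powr s"
    using continuous_attains_sup[OF compact_cball _ cont] by blast
  then have z: "norm z \<le> \<rho>"
    and max: "\<And>w. norm w \<le> \<rho> \<Longrightarrow>
                norm (f w) * (\<rho> - norm w) powr s \<le> norm (f z) * (\<rho> - norm z) powr s"
    by simp_all
  have K: "norm (f z) * (\<rho> - norm z) powr s \<le> D * bergman_norm p f"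
  proof (cases "norm z = \<rho>")
    case True
    then show ?thesis by (simp add: D_def bergman_norm_nonneg)
  next
    case False
    with z have z: "norm z < \<rho>" by simp
    define r where "r = (\<rho> - norm z) / (8 * 2 powr s)"
    have r: "0 \<le> r" using z by (simp add: r_def)
    have "r \<le> \<rho> - norm z"
    proof -
      have "1 \<le> 8 * (2::real) powr s" using ge_one_powr_ge_zero[of 2 s] s by simp
      then show ?thesis using z unfolding r_def by (simp add: divide_le_eq mult_le_cancel_left1)
    qed
    then have sub: "ball z r \<subseteq> unit_disc"
      using \<rho>(1) by (simp add: ball_subset_ball_iff)
    have "norm (f z) / 2 \<le> norm (f w)" if "w \<in> ball z r" for w
      using norm_ge_half_near_weighted_max[OF bergman_analytic[OF f] \<rho>(1) z, of s w]
        max that s by (simp add: r_def)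
    then have "norm (f z) / 2 * r powr (2 / p) \<le> bergman_norm p f"
      by (intro bergman_norm_ge_ball[OF f p r sub]) auto
    moreover have "r powr s = (\<rho> - norm z) powr s / (8 * 2 powr s) powr s"
      unfolding r_def by (rule powr_divide)
    ultimately show ?thesis
      by (simp add: s_def[symmetric] D_def field_simps)
  qed
  have "1 - norm a = 2 * (\<rho> - norm a)" by (simp add: \<rho>_def field_simps)
  then have "(1 - norm a) powr s = 2 powr s * (\<rho> - norm a) powr s"
    by (simp only: powr_mult)
  then have "norm (f a) * (1 - norm a) powr s = 2 powr s * (norm (f a) * (\<rho> - norm a) powr s)"
    by simp
  also have "\<dots> \<le> 2 powr s * (D * bergman_norm p f)"
    using max[of a] \<rho>(2) K by (intro mult_left_mono) auto
  finally show "norm (f a) * (1 - norm a) powr (2 / p) \<le> 2 powr s * D * bergman_norm p f"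
    by (simp add: s_def)
qed

text \<open>
Cauchy's estimate on the disc of radius \<open>(1 - norm z) / 2\<close>: differentiation costs one power of the
distance to the circle.
\<close>

lemma norm_deriv_le_of_growth:
  assumes f: "f analytic_on unit_disc" and s: "0 \<le> s"
    and growth: "\<And>w. w \<in> unit_disc \<Longrightarrow> norm (f w) * (1 - norm w) powr s \<le> K"
    and z: "z \<in> unit_disc"
  shows "norm (deriv f z) * (1 - norm z) powr (1 + s) \<le> 2 powr (1 + s) * K"
proof -
  define t where "t = 1 - norm z"
  have t: "t > 0" using z by (simp add: t_def)
  have near: "t / 2 \<le> 1 - norm w" if "w \<in> cball z (t / 2)" for w
  proof -
    have "norm w \<le> norm z + dist z w" by (rule norm_le_add_dist)
    then show ?thesis using that by (simp add: t_def field_simps)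
  qed
  have "norm (deriv f z) \<le> K / (t / 2) powr s / (t / 2)"
  proof (rule norm_deriv_le_Cauchy)
    have "w \<in> unit_disc" if "w \<in> cball z (t / 2)" for w
      using near[OF that] t by simp
    then show "f analytic_on cball z (t / 2)"
      using analytic_on_subset[OF f] by blast
    fix w assume w: "w \<in> cball z (t / 2)"
    have "norm (f w) * (t / 2) powr s \<le> norm (f w) * (1 - norm w) powr s"
      using near[OF w] t s by (intro mult_left_mono powr_mono2) auto
    also have "\<dots> \<le> K" using near[OF w] t by (intro growth) simp
    finally show "norm (f w) \<le> K / (t / 2) powr s" using t by (simp add: field_simps)
  qed (use t in auto)
  also have "\<dots> = 2 powr (1 + s) * K / t powr (1 + s)"
    using t by (simp add: powr_add powr_divide field_simps)
  finally show ?thesis using t by (simp add: field_simps t_def)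
qed

section \<open>Composition operators and Bloch functions\<close>

lemma analytic_self_map_in_disc:
  assumes "analytic_self_map \<phi>" "z \<in> unit_disc"
  shows "\<phi> z \<in> unit_disc"
  using assms unfolding analytic_self_map_def by blast

lemma comp_op_in_analytic_disc:
  assumes "analytic_self_map \<phi>" "f analytic_on unit_disc"
  shows "comp_op \<phi> f \<in> analytic_disc"
proof -
  have "f \<circ> \<phi> holomorphic_on unit_disc"
    using assms by (intro holomorphic_on_compose_gen[where t = unit_disc])
      (auto simp: analytic_self_map_def analytic_imp_holomorphic)
  then have "comp_op \<phi> f holomorphic_on unit_disc"
    by (rule holomorphic_transform) (simp add: comp_op_def)
  then show ?thesis
    unfolding analytic_disc_def by (simp add: analytic_on_open) (simp add: comp_op_def)
qed

lemma norm_deriv_comp_op: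
  assumes \<phi>: "analytic_self_map \<phi>" and f: "f analytic_on unit_disc" and z: "z \<in> unit_disc"
  shows "norm (deriv (comp_op \<phi> f) z) = norm (deriv f (\<phi> z)) * norm (deriv \<phi> z)"
proof -
  have "\<phi> z \<in> unit_disc" using analytic_self_map_in_disc[OF \<phi> z] .
  then have "(f has_field_derivative deriv f (\<phi> z)) (at (\<phi> z))"
    using analytic_on_imp_differentiable_at[OF f] by (simp add: DERIV_deriv_iff_field_differentiable)
  moreover have "(\<phi> has_field_derivative deriv \<phi> z) (at z)"
    using \<phi> z analytic_on_imp_differentiable_at[of \<phi> unit_disc z]
    by (simp add: analytic_self_map_def DERIV_deriv_iff_field_differentiable)
  ultimately have "((\<lambda>z. f (\<phi> z)) has_field_derivative deriv f (\<phi> z) * deriv \<phi> z) (at z)"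
    by (rule DERIV_chain2)
  then have "(comp_op \<phi> f has_field_derivative deriv f (\<phi> z) * deriv \<phi> z) (at z)"
    by (rule has_field_derivative_transform_within_open[where S = unit_disc])
      (use z in \<open>auto simp: comp_op_def\<close>)
  then show ?thesis
    by (simp add: DERIV_imp_deriv norm_mult)
qed

lemma comp_op_diff: "comp_op \<phi> (\<lambda>w. f w - g w) = (\<lambda>z. comp_op \<phi> f z - comp_op \<phi> g z)"
  by (auto simp: comp_op_def)

lemma one_minus_norm_sq_le:
  fixes z :: complex
  shows "1 - (norm z)\<^sup>2 \<le> 2 * (1 - norm z)"
  using zero_le_power2[of "1 - norm z"] by (simp add: power2_eq_square algebra_simps)

text \<open>
A weak form of the Schwarz-Pick inequality; the constant 4 suffices and comes from Cauchy's estimate.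
\<close>

lemma self_map_weight_le:
  assumes \<phi>: "analytic_self_map \<phi>" and z: "z \<in> unit_disc"
  shows "(1 - (norm z)\<^sup>2) * norm (deriv \<phi> z) \<le> 4"
proof -
  have "norm (deriv \<phi> z) * (1 - norm z) powr (1 + 0) \<le> 2 powr (1 + 0) * 1"
  proof (rule norm_deriv_le_of_growth[OF _ _ _ z])
    show "\<phi> analytic_on unit_disc" using \<phi> by (simp add: analytic_self_map_def)
    show "norm (\<phi> w) * (1 - norm w) powr 0 \<le> 1" if "w \<in> unit_disc" for w
    proof -
      show ?thesis using analytic_self_map_in_disc[OF \<phi> that] by simp
    qed
  qed simp
  then have "norm (deriv \<phi> z) * (1 - norm z) \<le> 2" using z by simp
  then have "2 * (1 - norm z) * norm (deriv \<phi> z) \<le> 4" by (simp add: algebra_simps)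
  moreover have "(1 - (norm z)\<^sup>2) * norm (deriv \<phi> z) \<le> 2 * (1 - norm z) * norm (deriv \<phi> z)"
    by (intro mult_right_mono one_minus_norm_sq_le) simp
  ultimately show ?thesis by linarith
qed

lemma compact_subset_unit_disc:
  assumes "compact K" "K \<subseteq> unit_disc"
  obtains \<rho> where "\<rho> < 1" "K \<subseteq> cball 0 \<rho>"
proof (cases "K = {}")
  case True
  then show ?thesis using that[of 0] by simp
next
  case False
  then obtain x where x: "x \<in> K" "\<forall>y\<in>K. norm y \<le> norm x"
    using continuous_attains_sup[OF assms(1) _ continuous_on_norm_id] by blast
  show ?thesis
  proof (rule that)
    show "norm x < 1" using x(1) assms(2) by auto
    show "K \<subseteq> cball 0 (norm x)" using x(2) by auto
  qed
qed

lemma bloch_if_weight_le: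
  assumes "f \<in> analytic_disc" "\<And>z. z \<in> unit_disc \<Longrightarrow> (1 - (norm z)\<^sup>2) * norm (deriv f z) \<le> e"
  shows "f \<in> bloch" "bloch_norm f \<le> norm (f 0) + e"
proof -
  show "f \<in> bloch"
    using assms unfolding bloch_def by (auto intro!: bdd_aboveI2)
  show "bloch_norm f \<le> norm (f 0) + e"
    using assms(2) unfolding bloch_norm_def bloch_seminorm_def by (auto intro!: cSUP_least)
qed

section \<open>Sufficiency of the boundary condition\<close>

text \<open>
Where \<open>\<phi> z\<close> is close to the circle, the growth bound for \<open>deriv (D n)\<close> is absorbed by the small
quotient of the boundary condition. Where \<open>norm (\<phi> z) \<le> \<delta>\<close>, the derivatives \<open>deriv (D n) (\<phi> z)\<close> tend to
zero uniformly and the weight of \<open>\<phi>\<close> is bounded.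
\<close>

lemma composite_weight_uniformly_small:
  fixes D :: "nat \<Rightarrow> complex \<Rightarrow> complex"
  assumes \<phi>: "analytic_self_map \<phi>" and s: "0 \<le> s"
    and vanish: "vanishes_at_boundary_values \<phi>
      (\<lambda>z. (1 - (norm z)\<^sup>2) * norm (deriv \<phi> z) / (1 - (norm (\<phi> z))\<^sup>2) powr (1 + s))"
    and D: "\<And>n. D n analytic_on unit_disc"
    and growth: "\<And>n w. w \<in> unit_disc \<Longrightarrow> norm (D n w) * (1 - norm w) powr s \<le> K"
    and lim: "\<And>X. compact X \<Longrightarrow> X \<subseteq> unit_disc \<Longrightarrow> uniform_limit X D (\<lambda>_. 0) sequentially"
    and e: "0 < e"
  shows "\<forall>\<^sub>F n in sequentially. \<forall>z\<in>unit_disc.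
           (1 - (norm z)\<^sup>2) * norm (deriv (comp_op \<phi> (D n)) z) \<le> e"
proof -
  define F where
    "F z = (1 - (norm z)\<^sup>2) * norm (deriv \<phi> z) / (1 - (norm (\<phi> z))\<^sup>2) powr (1 + s)" for z
  \<comment> \<open>One factor \<open>2 powr (1 + s)\<close> comes from differentiating, the other from \<open>1 - x\<^sup>2 \<le> 2 * (1 - x)\<close>.\<close>
  define A where "A = 4 powr (1 + s) * K"
  have "norm (D 0 0) \<le> K" using growth[of 0 0] by simp
  then have K: "0 \<le> K" using norm_ge_zero order_trans by blast
  then have A: "0 \<le> A" by (simp add: A_def)
  obtain \<delta> where \<delta>: "0 < \<delta>" "\<delta> < 1"
    and F: "\<And>z. z \<in> unit_disc \<Longrightarrow> \<delta> < norm (\<phi> z) \<Longrightarrow> norm (\<phi> z) < 1 \<Longrightarrow> \<bar>F z\<bar> < e / (A + 1)"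
    using vanish A e unfolding vanishes_at_boundary_values_def F_def
    by (metis add_nonneg_pos divide_pos_pos zero_less_one)
  \<comment> \<open>A bound \<open>\<eta>\<close> on \<open>cball 0 ((1 + \<delta>) / 2)\<close> gives derivatives of size \<open>e / 4\<close> on \<open>cball 0 \<delta>\<close>.\<close>
  define \<eta> where "\<eta> = e * (1 - \<delta>) / 8"
  have \<eta>: "0 < \<eta>" using \<delta> e by (simp add: \<eta>_def)
  have "uniform_limit (cball 0 ((1 + \<delta>) / 2)) D (\<lambda>_. 0) sequentially"
    using \<delta> by (intro lim) auto
  then have "\<forall>\<^sub>F n in sequentially. \<forall>w\<in>cball 0 ((1 + \<delta>) / 2). norm (D n w) < \<eta>"
    using \<eta> by (auto simp: uniform_limit_iff)
  then show ?thesis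
  proof eventually_elim
    case (elim n)
    show ?case
    proof
      fix z assume z: "z \<in> unit_disc"
      then have \<phi>z: "norm (\<phi> z) < 1" using analytic_self_map_in_disc[OF \<phi>] by simp
      have W: "(1 - (norm z)\<^sup>2) * norm (deriv (comp_op \<phi> (D n)) z) =
          (1 - (norm z)\<^sup>2) * norm (deriv \<phi> z) * norm (deriv (D n) (\<phi> z))"
        by (simp add: norm_deriv_comp_op[OF \<phi> D z])
      show "(1 - (norm z)\<^sup>2) * norm (deriv (comp_op \<phi> (D n)) z) \<le> e"
      proof (cases "\<delta> < norm (\<phi> z)")
        case True
        define t where "t = 1 - norm (\<phi> z)"
        define q where "q = 1 - (norm (\<phi> z))\<^sup>2"
        have t: "0 < t" using \<phi>z by (simp add: t_def)
        have q: "0 < q" using \<phi>z by (simp add: q_def power_less_one_iff)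
        have "norm (deriv (D n) (\<phi> z)) * t powr (1 + s) \<le> 2 powr (1 + s) * K"
          unfolding t_def using \<phi>z by (intro norm_deriv_le_of_growth[OF D s growth]) auto
        then have "2 powr (1 + s) * (norm (deriv (D n) (\<phi> z)) * t powr (1 + s)) \<le>
            2 powr (1 + s) * (2 powr (1 + s) * K)"
          by (intro mult_left_mono) auto
        moreover have "(4 :: real) powr (1 + s) = 2 powr (1 + s) * 2 powr (1 + s)"
          using powr_mult[of 2 2 "1 + s"] by simp
        moreover have "(2 * t) powr (1 + s) = 2 powr (1 + s) * t powr (1 + s)"
          by (rule powr_mult)
        ultimately have "norm (deriv (D n) (\<phi> z)) * (2 * t) powr (1 + s) \<le> A"
          by (simp only: A_def mult.assoc mult.left_commute)
        moreover have "q powr (1 + s) \<le> (2 * t) powr (1 + s)"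
          using one_minus_norm_sq_le[of "\<phi> z"] q s unfolding q_def t_def
          by (intro powr_mono2) auto
        ultimately have "norm (deriv (D n) (\<phi> z)) * q powr (1 + s) \<le> A"
          by (meson mult_left_mono norm_ge_zero order_trans)
        moreover have "0 \<le> F z"
          using unit_disc_weight_nonneg[OF z] by (simp add: F_def)
        ultimately have "F z * (norm (deriv (D n) (\<phi> z)) * q powr (1 + s)) \<le> e / (A + 1) * A"
          using F[OF z True \<phi>z] A by (intro mult_mono) auto
        also have "\<dots> \<le> e" using A e by (simp add: field_simps)
        also have "F z * (norm (deriv (D n) (\<phi> z)) * q powr (1 + s)) =
            (1 - (norm z)\<^sup>2) * norm (deriv (comp_op \<phi> (D n)) z)"
          using q unfolding W F_def q_def[symmetric] by simp
        finally show ?thesis .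
      next
        case False
        have near: "norm w \<le> (1 + \<delta>) / 2" if "w \<in> cball (\<phi> z) ((1 - \<delta>) / 2)" for w
        proof -
          have "norm w \<le> norm (\<phi> z) + dist (\<phi> z) w" by (rule norm_le_add_dist)
          then show ?thesis using that False by (simp add: field_simps)
        qed
        have "norm (deriv (D n) (\<phi> z)) \<le> \<eta> / ((1 - \<delta>) / 2)"
        proof (rule norm_deriv_le_Cauchy)
          have "w \<in> unit_disc" if "w \<in> cball (\<phi> z) ((1 - \<delta>) / 2)" for w
            using near[OF that] \<delta> by simp
          then show "D n analytic_on cball (\<phi> z) ((1 - \<delta>) / 2)"
            using analytic_on_subset[OF D] by blast
          show "norm (D n w) \<le> \<eta>" if "w \<in> cball (\<phi> z) ((1 - \<delta>) / 2)" for w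
            using elim near[OF that] by (simp add: less_imp_le)
        qed (use \<delta> in auto)
        also have "\<dots> = e / 4" using \<delta> by (simp add: \<eta>_def field_simps)
        finally have "(1 - (norm z)\<^sup>2) * norm (deriv \<phi> z) * norm (deriv (D n) (\<phi> z)) \<le> 4 * (e / 4)"
          using self_map_weight_le[OF \<phi> z] unit_disc_weight_nonneg[OF z]
          by (intro mult_mono) auto
        then show ?thesis unfolding W by simp
      qed
    qed
  qed
qed

text \<open>
The growth estimate makes norm-bounded subsets of \<open>A\<^sup>p\<close> normal families. The limit inherits the
growth estimate pointwise, and the differences satisfy it as well, with twice the constant.
\<close>

lemma bergman_normal_family:
  assumes p: "0 < p" and f: "\<And>n. f n \<in> bergman p" "\<And>n. bergman_norm p (f n) \<le> M"
  obtains g r K where "g analytic_on unit_disc" "strict_mono (r :: nat \<Rightarrow> nat)"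
    "\<And>X. compact X \<Longrightarrow> X \<subseteq> unit_disc \<Longrightarrow>
       uniform_limit X (\<lambda>n w. f (r n) w - g w) (\<lambda>_. 0) sequentially"
    "\<And>n w. w \<in> unit_disc \<Longrightarrow> norm (f (r n) w - g w) * (1 - norm w) powr (2 / p) \<le> K"
proof -
  obtain C where C: "0 < C" "\<And>f z. f \<in> bergman p \<Longrightarrow> z \<in> unit_disc \<Longrightarrow>
       norm (f z) * (1 - norm z) powr (2 / p) \<le> C * bergman_norm p f"
    using bergman_growth[OF p] by blast
  define K where "K = C * M"
  have growth: "norm (f n w) * (1 - norm w) powr (2 / p) \<le> K" if "w \<in> unit_disc" for n w
    unfolding K_def using C(2)[OF f(1) that] mult_left_mono[OF f(2)] C(1)
    by (meson less_imp_le order_trans)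
  have bounded: "\<exists>B. \<forall>h\<in>range f. \<forall>z\<in>X. norm (h z) \<le> B" if X: "compact X" "X \<subseteq> unit_disc" for X
  proof -
    obtain \<rho> where \<rho>: "\<rho> < 1" "X \<subseteq> cball 0 \<rho>"
      using compact_subset_unit_disc[OF X] .
    have "norm (f n z) \<le> K / (1 - \<rho>) powr (2 / p)" if "z \<in> X" for n z
    proof -
      have "norm (f n z) * (1 - \<rho>) powr (2 / p) \<le> norm (f n z) * (1 - norm z) powr (2 / p)"
        using \<rho> that p by (intro mult_left_mono powr_mono2) auto
      also have "\<dots> \<le> K" using that X(2) by (intro growth) blast
      finally show ?thesis using \<rho>(1) by (simp add: field_simps)
    qed
    then show ?thesis by blast
  qed
  have hol: "h holomorphic_on unit_disc" if "h \<in> range f" for h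
    using that bergman_analytic[OF f(1)] analytic_imp_holomorphic by blast
  obtain g r where g: "g holomorphic_on unit_disc" and r: "strict_mono (r :: nat \<Rightarrow> nat)"
    and pt: "\<And>x. x \<in> unit_disc \<Longrightarrow> ((\<lambda>n. f (r n) x) \<longlongrightarrow> g x) sequentially"
    and unif: "\<And>X. compact X \<Longrightarrow> X \<subseteq> unit_disc \<Longrightarrow> uniform_limit X (f \<circ> r) g sequentially"
    using Montel[OF open_ball hol bounded order_refl] by blast
  have g_growth: "norm (g w) * (1 - norm w) powr (2 / p) \<le> K" if "w \<in> unit_disc" for w
    by (rule tendsto_upperbound[OF tendsto_mult[OF tendsto_norm[OF pt[OF that]] tendsto_const]])
      (use growth[OF that] in auto)
  show thesis
  proof
    show "g analytic_on unit_disc" using g by (simp add: analytic_on_open)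
    show "uniform_limit X (\<lambda>n w. f (r n) w - g w) (\<lambda>_. 0) sequentially"
      if "compact X" "X \<subseteq> unit_disc" for X
      using unif[OF that] by (simp add: uniform_limit_iff dist_norm)
    fix n w assume w: "w \<in> unit_disc"
    have "norm (f (r n) w - g w) * (1 - norm w) powr (2 / p) \<le>
        (norm (f (r n) w) + norm (g w)) * (1 - norm w) powr (2 / p)"
      by (intro mult_right_mono norm_triangle_ineq4) simp
    also have "\<dots> \<le> K + K"
      using growth[OF w, of "r n"] g_growth[OF w] by (simp add: distrib_right)
    finally show "norm (f (r n) w - g w) * (1 - norm w) powr (2 / p) \<le> K + K" .
  qed fact
qed

lemma bloch_convergent_subsequence:
  assumes \<phi>: "analytic_self_map \<phi>" and p: "0 < p"
    and range: "comp_op \<phi> ` bergman p \<subseteq> bloch"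
    and vanish: "vanishes_at_boundary_values \<phi>
      (\<lambda>z. (1 - (norm z)\<^sup>2) * norm (deriv \<phi> z) / (1 - (norm (\<phi> z))\<^sup>2) powr (1 + 2 / p))"
    and f: "\<And>n. f n \<in> bergman p" "\<And>n. bergman_norm p (f n) \<le> M"
  obtains h r where "strict_mono (r :: nat \<Rightarrow> nat)"
    "limitin bloch_topology (\<lambda>n. comp_op \<phi> (f (r n))) h sequentially"
proof -
  interpret Bl: Metric_space bloch bloch_dist by (rule bloch_metric_space)
  obtain g r K where g: "g analytic_on unit_disc" and r: "strict_mono (r :: nat \<Rightarrow> nat)"
    and lim: "\<And>X. compact X \<Longrightarrow> X \<subseteq> unit_disc \<Longrightarrow>
       uniform_limit X (\<lambda>n w. f (r n) w - g w) (\<lambda>_. 0) sequentially"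
    and growth: "\<And>n w. w \<in> unit_disc \<Longrightarrow> norm (f (r n) w - g w) * (1 - norm w) powr (2 / p) \<le> K"
    by (rule bergman_normal_family[where f = f, OF p f]) blast
  define D where "D n w = f (r n) w - g w" for n w
  have D: "D n analytic_on unit_disc" for n
    unfolding D_def by (intro analytic_on_diff bergman_analytic[OF f(1)] g)
  have comp_D: "comp_op \<phi> (D n) = (\<lambda>z. comp_op \<phi> (f (r n)) z - comp_op \<phi> g z)" for n
    unfolding D_def by (rule comp_op_diff)
  have D_lim: "uniform_limit X D (\<lambda>_. 0) sequentially" if "compact X" "X \<subseteq> unit_disc" for X
    using lim[OF that] unfolding D_def .
  have weight: "\<forall>\<^sub>F n in sequentially. \<forall>z\<in>unit_disc.
      (1 - (norm z)\<^sup>2) * norm (deriv (comp_op \<phi> (D n)) z) \<le> e" if "e > 0" for e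
  proof (rule composite_weight_uniformly_small[OF \<phi> _ vanish D _ D_lim that])
    show "norm (D n w) * (1 - norm w) powr (2 / p) \<le> K" if "w \<in> unit_disc" for n w
      unfolding D_def by (rule growth[OF that])
  qed (use p in auto)
  have f_bloch: "comp_op \<phi> (f n) \<in> bloch" for n using range f(1) by blast
  have diff_bloch: "\<forall>\<^sub>F n in sequentially. comp_op \<phi> (D n) \<in> bloch \<and> bloch_norm (comp_op \<phi> (D n)) < e"
    if e: "e > 0" for e
  proof -
    have "\<phi> 0 \<in> unit_disc" by (rule analytic_self_map_in_disc[OF \<phi>]) simp
    then have "uniform_limit {\<phi> 0} D (\<lambda>_. 0) sequentially"
      by (intro D_lim) auto
    then have "\<forall>\<^sub>F n in sequentially. norm (D n (\<phi> 0)) < e / 2"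
      using half_gt_zero[OF e] unfolding uniform_limit_iff by (simp del: less_divide_eq_numeral1)
    with weight[OF half_gt_zero[OF e]] show ?thesis
    proof eventually_elim
      case (elim n)
      have "comp_op \<phi> (D n) \<in> analytic_disc"
        by (rule comp_op_in_analytic_disc[OF \<phi> D])
      note small = bloch_if_weight_le[OF this elim(1)[rule_format]]
      have "norm (comp_op \<phi> (D n) 0) < e / 2"
        using elim(2) by (simp add: comp_op_def)
      with small show ?case by linarith
    qed
  qed
  \<comment> \<open>The limit belongs to the Bloch space because it differs from some \<open>comp_op \<phi> (f (r n))\<close> by a Bloch function.\<close>
  have h: "comp_op \<phi> g \<in> bloch"
  proof -
    obtain n where "comp_op \<phi> (D n) \<in> bloch"
      using diff_bloch[OF zero_less_one] unfolding eventually_sequentially by blast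
    from bloch_diff[OF f_bloch this, of "r n"] show ?thesis
      by (simp add: comp_D)
  qed
  have "limitin bloch_topology (\<lambda>n. comp_op \<phi> (f (r n))) (comp_op \<phi> g) sequentially"
    unfolding bloch_topology_def Bl.limitin_metric
  proof (intro conjI h allI impI)
    fix e :: real assume "e > 0"
    from diff_bloch[OF this] show "\<forall>\<^sub>F n in sequentially. comp_op \<phi> (f (r n)) \<in> bloch \<and>
        bloch_dist (comp_op \<phi> (f (r n))) (comp_op \<phi> g) < e"
      by eventually_elim (simp add: bloch_dist_def f_bloch h comp_D)
  qed
  with r show thesis by (rule that)
qed

text \<open>
Relative compactness can be tested on sequences from \<open>S\<close> itself, because a limit point of every infinite
subset of \<open>S\<close> is enough.
\<close>

lemma (in Metric_space) compactin_closure_of_if_subseq_convergent: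
  assumes "S \<subseteq> M"
    and "\<And>\<sigma> :: nat \<Rightarrow> 'a. range \<sigma> \<subseteq> S \<Longrightarrow>
           \<exists>l r. strict_mono r \<and> limitin mtopology (\<sigma> \<circ> r) l sequentially"
  shows "compactin mtopology (mtopology closure_of S)"
proof -
  have "\<exists>l r. l \<in> M \<and> strict_mono r \<and> limitin mtopology (\<sigma> \<circ> r) l sequentially"
    if "range \<sigma> \<subseteq> S" for \<sigma> :: "nat \<Rightarrow> 'a"
    using assms(2)[OF that] limitin_mspace by blast
  then show ?thesis
    using Bolzano_Weierstrass_property[OF assms(1,1)]
    unfolding compact_closure_of_eq_Bolzano_Weierstrass by blast
qed

lemma vanishes_imp_compact:
  assumes \<phi>: "analytic_self_map \<phi>" and p: "0 < p"
    and range: "comp_op \<phi> ` bergman p \<subseteq> bloch"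
    and vanish: "vanishes_at_boundary_values \<phi>
      (\<lambda>z. (1 - (norm z)\<^sup>2) * norm (deriv \<phi> z) / (1 - (norm (\<phi> z))\<^sup>2) powr (1 + 2 / p))"
  shows "compact_operator (bergman p) (bergman_norm p) bloch_topology (comp_op \<phi>)"
  unfolding compact_operator_def
proof (intro allI impI conjI)
  interpret Bl: Metric_space bloch bloch_dist by (rule bloch_metric_space)
  fix S assume "norm_bounded (bergman p) (bergman_norm p) S"
  then obtain M where S: "S \<subseteq> bergman p" and M: "\<And>f. f \<in> S \<Longrightarrow> bergman_norm p f \<le> M"
    unfolding norm_bounded_def by blast
  have image: "comp_op \<phi> ` S \<subseteq> bloch" using range S by blast
  then show "comp_op \<phi> ` S \<subseteq> topspace bloch_topology"
    by (simp add: topspace_bloch_topology)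
  show "compactin bloch_topology (bloch_topology closure_of (comp_op \<phi> ` S))"
    unfolding bloch_topology_def
  proof (rule Bl.compactin_closure_of_if_subseq_convergent[OF image])
    fix \<sigma> :: "nat \<Rightarrow> complex \<Rightarrow> complex" assume "range \<sigma> \<subseteq> comp_op \<phi> ` S"
    then have "\<forall>n. \<exists>g\<in>S. \<sigma> n = comp_op \<phi> g" by blast
    then obtain f where f: "\<And>n. f n \<in> S" "\<And>n. \<sigma> n = comp_op \<phi> (f n)" by metis
    have bounded: "f n \<in> bergman p" "bergman_norm p (f n) \<le> M" for n using f(1) S M by blast+
    obtain h r where "strict_mono (r :: nat \<Rightarrow> nat)"
      "limitin bloch_topology (\<lambda>n. comp_op \<phi> (f (r n))) h sequentially"
      using bloch_convergent_subsequence[where f = f, OF \<phi> p range vanish bounded] .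
    then show "\<exists>l r. strict_mono r \<and> limitin Bl.mtopology (\<sigma> \<circ> r) l sequentially"
      unfolding bloch_topology_def comp_def f(2) by blast
  qed
qed

section \<open>Test functions in the Bergman space\<close>

lemma one_minus_norm_le_norm_kernel:
  assumes "norm a < 1" "norm w < 1"
  shows "1 - norm a \<le> norm (1 - cnj a * w)" "1 - norm w \<le> norm (1 - cnj a * w)"
proof -
  have *: "1 - norm a * norm w \<le> norm (1 - cnj a * w)"
    using norm_triangle_ineq2[of 1 "cnj a * w"] by (simp add: norm_mult)
  show "1 - norm a \<le> norm (1 - cnj a * w)"
    using * mult_left_le[of "norm w" "norm a"] assms by simp
  show "1 - norm w \<le> norm (1 - cnj a * w)"
    using * mult_left_le_one_le[of "norm w" "norm a"] assms by simp
qed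

text \<open>
The term with \<open>2 ^ j * t \<le> x < 2 ^ Suc j * t\<close> already dominates the left-hand side. The sum splits an
integral of a negative power into integrals over sublevel sets, whose areas are easy to bound.
\<close>

lemma powr_neg_le_dyadic_sum:
  fixes t x q :: real
  assumes "0 < t" "t \<le> x" "0 \<le> q"
  shows "ennreal (x powr -q) \<le>
    (\<Sum>j. ennreal ((2 ^ j * t) powr -q) * indicator {x<..} (2 ^ Suc j * t))"
proof -
  define j where "j = nat \<lfloor>log 2 (x / t)\<rfloor>"
  have "1 \<le> x / t" using assms by simp
  then have nonneg: "0 \<le> log 2 (x / t)" by simp
  have "real j \<le> log 2 (x / t)" "log 2 (x / t) < real (Suc j)"
    using nonneg unfolding j_def by linarith+
  then have j: "2 ^ j * t \<le> x" "x < 2 ^ Suc j * t"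
    using assms by (simp_all add: le_log_iff log_less_iff powr_realpow powr_add field_simps)
  have "ennreal (x powr -q) \<le> ennreal ((2 ^ j * t) powr -q)"
    using j(1) assms by (intro ennreal_leI powr_mono2') auto
  also have "\<dots> = (\<Sum>i\<in>{j}. ennreal ((2 ^ i * t) powr -q) * indicator {x<..} (2 ^ Suc i * t))"
    using j(2) by simp
  also have "\<dots> \<le> (\<Sum>j. ennreal ((2 ^ j * t) powr -q) * indicator {x<..} (2 ^ Suc j * t))"
    by (rule sum_le_suminf) auto
  finally show ?thesis .
qed

text \<open>
The sublevel set lies in a disc about the reflected point \<open>1 / cnj a\<close>, because
\<open>1 - cnj a * w = cnj a * (1 / cnj a - w)\<close>.
\<close>

lemma emeasure_kernel_sublevel:
  assumes a: "1 / 2 \<le> norm a" and s: "0 \<le> s"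
  shows "emeasure disc_area {w. norm (1 - cnj a * w) < s} \<le> ennreal (4 * s\<^sup>2)"
proof -
  have a0: "a \<noteq> 0" using a by auto
  have "{w. norm (1 - cnj a * w) < s} \<subseteq> ball (1 / cnj a) (2 * s)"
  proof
    fix w assume "w \<in> {w. norm (1 - cnj a * w) < s}"
    moreover have "1 - cnj a * w = cnj a * (1 / cnj a - w)"
      using a0 by (simp add: field_simps)
    ultimately have "norm a * dist (1 / cnj a) w < s"
      by (simp add: norm_mult dist_norm)
    moreover have "1 / 2 * dist (1 / cnj a) w \<le> norm a * dist (1 / cnj a) w"
      using a by (intro mult_right_mono) auto
    ultimately show "w \<in> ball (1 / cnj a) (2 * s)" by simp
  qed
  then have "emeasure disc_area {w. norm (1 - cnj a * w) < s} \<le>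
      emeasure disc_area (ball (1 / cnj a) (2 * s))"
    by (intro emeasure_mono) auto
  also have "\<dots> \<le> ennreal ((2 * s)\<^sup>2)"
    using s by (intro emeasure_disc_area_ball_le) simp
  finally show ?thesis by (simp add: power_mult_distrib)
qed

text \<open>
On the disc the kernel is at least \<open>t = 1 - norm a\<close>. The shell of size about \<open>2 ^ j * t\<close> has area
\<open>O((2 ^ j * t)\<^sup>2)\<close>, so the shells contribute \<open>O(t powr (2 - q) * 2 powr (j * (2 - q)))\<close>, a series which
\<open>q \<ge> 3\<close> makes dominated by a geometric one of ratio \<open>1 / 2\<close>.
\<close>

lemma nn_integral_kernel_le:
  assumes a: "1 / 2 \<le> norm a" "norm a < 1" and q: "3 \<le> q"
  shows "(\<integral>\<^sup>+w. ennreal (norm (1 - cnj a * w) powr -q) \<partial>disc_area)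
           \<le> ennreal (32 * (1 - norm a) powr (2 - q))"
proof -
  define t where "t = 1 - norm a"
  have t: "t > 0" using a by (simp add: t_def)
  define E where "E j = {w. norm (1 - cnj a * w) < 2 ^ Suc j * t}" for j :: nat
  have "{w. norm (1 - cnj a * w) < c} \<in> sets borel" for c :: real
    by (intro borel_open open_Collect_less continuous_intros)
  then have E [measurable]: "E j \<in> sets borel" for j by (simp add: E_def)
  have "AE w in disc_area. ennreal (norm (1 - cnj a * w) powr -q) \<le>
      (\<Sum>j. ennreal ((2 ^ j * t) powr -q) * indicator (E j) w)"
    unfolding disc_area_def
  proof (rule AE_uniform_measureI, simp, intro AE_I2 impI)
    fix w :: complex assume "w \<in> unit_disc"
    then have "t \<le> norm (1 - cnj a * w)"
      using one_minus_norm_le_norm_kernel(1)[of a w] a by (simp add: t_def)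
    from powr_neg_le_dyadic_sum[OF t this, of q] q
    show "ennreal (norm (1 - cnj a * w) powr -q) \<le>
        (\<Sum>j. ennreal ((2 ^ j * t) powr -q) * indicator (E j) w)"
      by (simp add: E_def indicator_def)
  qed
  then have "(\<integral>\<^sup>+w. ennreal (norm (1 - cnj a * w) powr -q) \<partial>disc_area) \<le>
      (\<integral>\<^sup>+w. (\<Sum>j. ennreal ((2 ^ j * t) powr -q) * indicator (E j) w) \<partial>disc_area)"
    by (rule nn_integral_mono_AE)
  also have "\<dots> = (\<Sum>j. ennreal ((2 ^ j * t) powr -q) * emeasure disc_area (E j))"
    by (subst nn_integral_suminf) (auto simp: nn_integral_cmult_indicator)
  also have "\<dots> \<le> (\<Sum>j. ennreal (16 * t powr (2 - q) * (1 / 2) ^ j))"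
  proof (rule suminf_le)
    fix j
    have "ennreal ((2 ^ j * t) powr -q) * emeasure disc_area (E j) \<le>
        ennreal ((2 ^ j * t) powr -q) * ennreal (4 * (2 ^ Suc j * t)\<^sup>2)"
      unfolding E_def using t a by (intro mult_left_mono emeasure_kernel_sublevel) auto
    also have "\<dots> = ennreal (16 * t powr (2 - q) * (2 ^ j) powr (2 - q))"
    proof -
      have "(2 ^ j * t) powr -q * (4 * (2 ^ Suc j * t)\<^sup>2) = 16 * ((2 ^ j * t) powr -q * (2 ^ j * t)\<^sup>2)"
        by (simp add: power2_eq_square)
      also have "(2 ^ j * t) powr -q * (2 ^ j * t)\<^sup>2 = (2 ^ j * t) powr (2 - q)"
        using t by (simp add: powr_diff powr_minus field_simps)
      finally show ?thesis
        using t by (simp add: powr_mult mult_ac flip: ennreal_mult)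
    qed
    also have "\<dots> \<le> ennreal (16 * t powr (2 - q) * (1 / 2) ^ j)"
    proof -
      have "(2 ^ j) powr (2 - q) \<le> (2 ^ j :: real) powr (-1)"
        using q by (intro powr_mono) auto
      also have "\<dots> = (1 / 2) ^ j" by (simp add: powr_minus power_one_over field_simps)
      finally show ?thesis using t by (intro ennreal_leI mult_left_mono) auto
    qed
    finally show "ennreal ((2 ^ j * t) powr -q) * emeasure disc_area (E j) \<le>
        ennreal (16 * t powr (2 - q) * (1 / 2) ^ j)" .
  qed auto
  also have "\<dots> = ennreal (16 * t powr (2 - q) * 2)"
    using sums_mult[OF geometric_sums[of "1 / 2 :: real"], of "16 * t powr (2 - q)"] t
    by (intro suminf_ennreal_eq) auto
  finally show ?thesis by (simp add: t_def mult_ac)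
qed

lemma borel_measurable_analytic_disc:
  assumes "f \<in> analytic_disc"
  shows "f \<in> borel_measurable borel"
proof -
  have "continuous_on unit_disc f"
    using assms by (auto simp: analytic_disc_def
        intro: holomorphic_on_imp_continuous_on analytic_imp_holomorphic)
  then have "(\<lambda>w. indicator unit_disc w *\<^sub>R f w) \<in> borel_measurable borel"
    by (intro borel_measurable_continuous_on_indicator) auto
  also have "(\<lambda>w. indicator unit_disc w *\<^sub>R f w) = f"
    using assms by (auto simp: analytic_disc_def indicator_def)
  finally show ?thesis .
qed

text \<open>
Powers of the Szego kernel at \<open>a\<close>, scaled to have bounded norm in \<open>A\<^sup>p\<close>. An integer exponent \<open>k\<close> keeps
them free of branches of complex powers; any \<open>k\<close> with \<open>k * p \<ge> 3\<close> serves.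
\<close>

definition bergman_test :: "real \<Rightarrow> nat \<Rightarrow> complex \<Rightarrow> complex \<Rightarrow> complex" where
  "bergman_test p k a w =
     (if w \<in> unit_disc then of_real ((1 - norm a) powr (k - 2 / p)) / (1 - cnj a * w) ^ k else 0)"

lemma kernel_nonzero: "norm a < 1 \<Longrightarrow> norm w < 1 \<Longrightarrow> 1 - cnj a * w \<noteq> 0"
  using one_minus_norm_le_norm_kernel(1)[of a w] by auto

lemma has_field_derivative_bergman_test:
  assumes "norm a < 1" "norm w < 1"
  shows "(bergman_test p k a has_field_derivative
    of_real ((1 - norm a) powr (k - 2 / p)) * of_nat k * cnj a / (1 - cnj a * w) ^ Suc k) (at w)"
proof -
  have nz: "1 - cnj a * w \<noteq> 0" using kernel_nonzero[OF assms] .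
  have power: "((\<lambda>x. c / x ^ k) has_field_derivative - c * of_nat k / x ^ Suc k) (at x)"
    if "x \<noteq> 0" for c x :: complex
  proof -
    have "((\<lambda>x. c * inverse x ^ k) has_field_derivative - c * of_nat k * inverse x ^ Suc k) (at x)"
    proof (cases k)
      case (Suc n)
      have "((\<lambda>x. inverse x ^ k) has_field_derivative of_nat k * (-(inverse x * inverse x)) * inverse x ^ n) (at x)"
        using DERIV_power[OF DERIV_inverse[OF that], of k] by (simp add: Suc power2_eq_square mult.assoc)
      from DERIV_cmult[OF this, of c] show ?thesis by (simp add: Suc mult.assoc mult.left_commute)
    qed simp
    then show ?thesis by (simp only: divide_inverse power_inverse)
  qed
  have "((\<lambda>w. 1 - cnj a * w) has_field_derivative - cnj a) (at w)"
    by (auto intro!: derivative_eq_intros)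
  from DERIV_chain2[OF power[OF nz] this]
  have "((\<lambda>w. of_real ((1 - norm a) powr (k - 2 / p)) / (1 - cnj a * w) ^ k) has_field_derivative
      of_real ((1 - norm a) powr (k - 2 / p)) * of_nat k * cnj a / (1 - cnj a * w) ^ Suc k) (at w)"
    by simp
  then show ?thesis
    by (rule has_field_derivative_transform_within_open[where S = unit_disc])
      (use assms in \<open>auto simp: bergman_test_def\<close>)
qed

lemma bergman_test_bergman:
  assumes a: "1 / 2 \<le> norm a" "norm a < 1" and p: "0 < p" and k: "3 \<le> k * p"
  shows "bergman_test p k a \<in> bergman p"
    and "bergman_norm p (bergman_test p k a) \<le> 32 powr (1 / p)"
proof -
  define t where "t = 1 - norm a"
  have t: "t > 0" using a by (simp add: t_def)
  have pw: "norm (bergman_test p k a w) powr p =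
      t powr (k * p - 2) * norm (1 - cnj a * w) powr -(k * p)" if "w \<in> unit_disc" for w
  proof -
    have "norm (1 - cnj a * w) > 0" using kernel_nonzero[of a w] a that by simp
    then have "(norm (1 - cnj a * w) ^ k) powr p = norm (1 - cnj a * w) powr (k * p)"
      by (simp only: powr_powr powr_realpow[symmetric])
    moreover have "(k - 2 / p) * p = k * p - 2" using p by (simp add: field_simps)
    ultimately have "(t powr (k - 2 / p) / norm (1 - cnj a * w) ^ k) powr p =
        t powr (k * p - 2) / norm (1 - cnj a * w) powr (k * p)"
      by (simp add: powr_divide powr_powr)
    moreover have "norm (bergman_test p k a w) = t powr (k - 2 / p) / norm (1 - cnj a * w) ^ k"
      using that unfolding bergman_test_def t_def by (simp add: norm_divide norm_power)
    ultimately show ?thesis by (simp only: powr_minus_divide) simp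
  qed
  have "bergman_test p k a holomorphic_on unit_disc"
    unfolding holomorphic_on_open[OF open_ball]
    using has_field_derivative_bergman_test[OF a(2)] by (metis mem_ball_0)
  then have an: "bergman_test p k a \<in> analytic_disc"
    unfolding analytic_disc_def by (simp add: analytic_on_open) (simp add: bergman_test_def)
  note [measurable] = borel_measurable_analytic_disc[OF this]
  have "(\<integral>\<^sup>+w. ennreal (norm (bergman_test p k a w) powr p) \<partial>disc_area) \<le>
     (\<integral>\<^sup>+w. ennreal (t powr (k * p - 2)) * ennreal (norm (1 - cnj a * w) powr -(k * p)) \<partial>disc_area)"
    unfolding disc_area_def
  proof (intro nn_integral_mono_AE AE_uniform_measureI AE_I2 impI)
    fix w :: complex assume "w \<in> unit_disc"
    then show "ennreal (norm (bergman_test p k a w) powr p) \<le>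
        ennreal (t powr (k * p - 2)) * ennreal (norm (1 - cnj a * w) powr -(k * p))"
      by (simp only: pw ennreal_mult powr_ge_zero order_refl)
  qed simp
  also have "\<dots> = ennreal (t powr (k * p - 2)) *
      (\<integral>\<^sup>+w. ennreal (norm (1 - cnj a * w) powr -(k * p)) \<partial>disc_area)"
    by (intro nn_integral_cmult) simp
  also have "\<dots> \<le> ennreal (t powr (k * p - 2)) * ennreal (32 * t powr (2 - k * p))"
    unfolding t_def using a k by (intro mult_left_mono nn_integral_kernel_le) auto
  also have "\<dots> = ennreal 32"
  proof -
    have "t powr (k * p - 2) * t powr (2 - k * p) = 1"
      using t by (simp flip: powr_add)
    then have "t powr (k * p - 2) * (32 * t powr (2 - k * p)) = 32"
      by simp
    then show ?thesis by (simp only: ennreal_mult' [symmetric] powr_ge_zero)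
  qed
  finally have le: "(\<integral>\<^sup>+w. ennreal (norm (bergman_test p k a w) powr p) \<partial>disc_area) \<le> ennreal 32" .
  have int: "integrable disc_area (\<lambda>w. norm (bergman_test p k a w) powr p)"
    using le_less_trans[OF le ennreal_less_top] by (intro integrableI_bounded) simp_all
  show "bergman_test p k a \<in> bergman p"
    using an int by (simp add: bergman_def)
  have "(LINT w|disc_area. norm (bergman_test p k a w) powr p) \<le> 32"
  proof -
    have "ennreal (LINT w|disc_area. norm (bergman_test p k a w) powr p) \<le> ennreal 32"
      using le by (simp only: nn_integral_eq_integral[OF int] powr_ge_zero AE_I2)
    then show ?thesis by (simp only: ennreal_le_iff zero_le_numeral)
  qed
  then show "bergman_norm p (bergman_test p k a) \<le> 32 powr (1 / p)"
    unfolding bergman_norm_def using p by (intro powr_mono2) auto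
qed

lemma norm_deriv_bergman_test_le:
  assumes "norm a < 1" "norm w < 1"
  shows "norm (deriv (bergman_test p k a) w) \<le>
    k * (1 - norm a) powr (k - 2 / p) / (1 - norm w) ^ Suc k"
proof -
  have "norm (deriv (bergman_test p k a) w) =
      (1 - norm a) powr (k - 2 / p) * (k * norm a) / norm (1 - cnj a * w) ^ Suc k"
    using DERIV_imp_deriv[OF has_field_derivative_bergman_test[OF assms]]
    by (simp add: norm_divide norm_mult norm_power)
  also have "\<dots> \<le> (1 - norm a) powr (k - 2 / p) * k / (1 - norm w) ^ Suc k"
  proof -
    have "k * norm a \<le> k" using assms(1) by (simp add: mult_left_le)
    moreover have "(1 - norm w) ^ Suc k \<le> norm (1 - cnj a * w) ^ Suc k"
      using assms one_minus_norm_le_norm_kernel(2)[OF assms] by (intro power_mono) auto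
    moreover have "0 < (1 - norm w) ^ Suc k" using assms(2) by simp
    ultimately show ?thesis by (intro frac_le mult_left_mono) auto
  qed
  finally show ?thesis by (simp add: mult_ac)
qed

text \<open>
At its own centre the test function attains the extremal order of growth of derivatives in \<open>A\<^sup>p\<close>, which
is what the quotient in the compactness criterion compares with.
\<close>

lemma norm_deriv_bergman_test_centre_ge:
  assumes a: "1 / 2 \<le> norm a" "norm a < 1" and p: "0 < p" and k: "0 < k"
  shows "1 / 2 ^ (k + 2) / (1 - (norm a)\<^sup>2) powr (1 + 2 / p) \<le> norm (deriv (bergman_test p k a) a)"
proof -
  define t where "t = 1 - norm a"
  have t: "t > 0" "t \<le> 1 / 2" using a by (auto simp: t_def)
  have sq: "1 - (norm a)\<^sup>2 = t * (2 - t)" by (simp add: t_def power2_eq_square algebra_simps)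
  \<comment> \<open>Both \<open>1 - (norm a)\<^sup>2\<close> and the kernel at \<open>a\<close> equal \<open>t * (2 - t)\<close>, which lies between \<open>t\<close> and \<open>2 * t\<close>.\<close>
  have ker: "norm (1 - cnj a * a) = t * (2 - t)"
  proof -
    have "1 - cnj a * a = of_real (1 - (norm a)\<^sup>2)"
      by (simp only: of_real_diff of_real_1 complex_norm_square mult.commute)
    then have "norm (1 - cnj a * a) = \<bar>t * (2 - t)\<bar>"
      by (simp only: sq norm_of_real)
    then show ?thesis using t by simp
  qed
  have "1 / 2 ^ (k + 2) / (1 - (norm a)\<^sup>2) powr (1 + 2 / p) \<le> 1 / 2 ^ (k + 2) / t powr (1 + 2 / p)"
    unfolding sq using t p
    by (intro divide_left_mono powr_mono2 mult_pos_pos) (auto simp: mult_le_cancel_left1)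
  also have "\<dots> = t powr (k - 2 / p) * (1 * (1 / 2)) / (2 * t) ^ Suc k"
    using t by (simp add: powr_diff powr_add powr_realpow field_simps)
  also have "\<dots> \<le> t powr (k - 2 / p) * (k * norm a) / (t * (2 - t)) ^ Suc k"
  proof -
    have "1 * (1 / 2) \<le> k * norm a" using k a by (intro mult_mono) auto
    moreover have "t * (2 - t) \<le> 2 * t" using t by (simp add: algebra_simps)
    then have "(t * (2 - t)) ^ Suc k \<le> (2 * t) ^ Suc k" using t by (intro power_mono) auto
    moreover have "0 < (t * (2 - t)) ^ Suc k" using t by (intro zero_less_power mult_pos_pos) auto
    ultimately show ?thesis by (intro frac_le mult_left_mono) auto
  qed
  also have "\<dots> = norm (deriv (bergman_test p k a) a)"
    using DERIV_imp_deriv[OF has_field_derivative_bergman_test[OF a(2) a(2)], of p k] ker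
    by (simp add: norm_divide norm_mult norm_power t_def)
  finally show ?thesis .
qed

text \<open>
For fixed \<open>w\<close> the kernel stays above \<open>1 - norm w\<close>, so the positive power of \<open>1 - norm (a n)\<close> wins.
\<close>

lemma bergman_test_tendsto_0:
  assumes a: "\<And>n. norm (a n) < 1" "(\<lambda>n. norm (a n)) \<longlonglongrightarrow> 1" and k: "0 < k - 2 / p"
    and w: "w \<in> unit_disc"
  shows "(\<lambda>n. bergman_test p k (a n) w) \<longlonglongrightarrow> 0" "(\<lambda>n. deriv (bergman_test p k (a n)) w) \<longlonglongrightarrow> 0"
proof -
  have "(\<lambda>n. 1 - norm (a n)) \<longlonglongrightarrow> 0"
    using tendsto_diff[OF tendsto_const[of 1] a(2)] by simp
  moreover have "\<forall>\<^sub>F n in sequentially. 0 \<le> 1 - norm (a n)"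
    by (intro always_eventually allI) (simp add: a(1) less_imp_le)
  ultimately have t: "(\<lambda>n. (1 - norm (a n)) powr (k - 2 / p)) \<longlonglongrightarrow> 0"
    using k by (intro tendsto_zero_powrI[OF _ tendsto_const])
  have null: "(\<lambda>n. c * (1 - norm (a n)) powr (k - 2 / p) / d) \<longlonglongrightarrow> 0" for c d :: real
    using tendsto_mult[OF t tendsto_const[of "c / d"]] by (simp add: field_simps)
  have wn: "norm w < 1" using w by simp
  have "norm (bergman_test p k (a n) w) \<le>
      1 * (1 - norm (a n)) powr (k - 2 / p) / (1 - norm w) ^ k" for n
  proof -
    have "(1 - norm w) ^ k \<le> norm (1 - cnj (a n) * w) ^ k"
      using one_minus_norm_le_norm_kernel(2)[OF a(1) wn] wn by (intro power_mono) auto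
    moreover have "0 < (1 - norm w) ^ k" using wn by simp
    ultimately have "(1 - norm (a n)) powr (k - 2 / p) / norm (1 - cnj (a n) * w) ^ k \<le>
        (1 - norm (a n)) powr (k - 2 / p) / (1 - norm w) ^ k"
      by (intro frac_le powr_ge_zero order_refl)
    then show ?thesis
      using wn by (simp add: bergman_test_def norm_divide norm_power)
  qed
  then show "(\<lambda>n. bergman_test p k (a n) w) \<longlonglongrightarrow> 0"
    by (intro Lim_null_comparison[OF always_eventually null] allI)
  show "(\<lambda>n. deriv (bergman_test p k (a n)) w) \<longlonglongrightarrow> 0"
    using norm_deriv_bergman_test_le[OF a(1) wn]
    by (intro Lim_null_comparison[OF always_eventually null] allI)
qed

section \<open>Necessity of the boundary condition\<close>

text \<open>
Convergence in the Bloch norm implies pointwise convergence of the derivatives and of the values at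
the origin, so pointwise data identify the limit \<open>l\<close> as zero.
\<close>

lemma bloch_norm_tendsto_0_if_pointwise:
  assumes lim: "limitin bloch_topology u l sequentially" and u: "\<And>n. u n \<in> bloch"
    and u0: "(\<lambda>n. u n 0) \<longlonglongrightarrow> 0"
    and deriv: "\<And>z. z \<in> unit_disc \<Longrightarrow> (\<lambda>n. deriv (u n) z) \<longlonglongrightarrow> 0"
  shows "(\<lambda>n. bloch_norm (u n)) \<longlonglongrightarrow> 0"
proof -
  interpret Bl: Metric_space bloch bloch_dist by (rule bloch_metric_space)
  have l: "l \<in> bloch"
    using lim unfolding bloch_topology_def by (rule Bl.limitin_mspace)
  have dist: "(\<lambda>n. bloch_norm (\<lambda>z. u n z - l z)) \<longlonglongrightarrow> 0"
    using lim u bloch_norm_nonneg[OF bloch_diff[OF u l]] l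
    unfolding bloch_topology_def Bl.limitin_metric
    by (simp add: tendsto_iff bloch_dist_def)
  have "l 0 = 0"
  proof -
    have "norm (u n 0 - l 0) \<le> bloch_norm (\<lambda>z. u n z - l z)" for n
      using bloch_seminorm_nonneg[OF bloch_diff[OF u l]] by (simp add: bloch_norm_def)
    then have "(\<lambda>n. u n 0 - l 0) \<longlonglongrightarrow> 0"
      using dist by (intro Lim_null_comparison[OF _ dist]) auto
    then have "(\<lambda>n. u n 0) \<longlonglongrightarrow> l 0" by (rule LIM_zero_cancel)
    then show ?thesis using u0 LIMSEQ_unique by blast
  qed
  moreover have "(1 - (norm z)\<^sup>2) * norm (deriv l z) \<le> 0" if z: "z \<in> unit_disc" for z
  proof -
    have le: "(1 - (norm z)\<^sup>2) * norm (deriv (u n) z - deriv l z) \<le> bloch_norm (\<lambda>z. u n z - l z)" for n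
    proof -
      have "deriv (\<lambda>z. u n z - l z) z = deriv (u n) z - deriv l z"
        using u l z by (intro deriv_diff bloch_differentiable)
      then show ?thesis
        using bloch_weight_le[OF bloch_diff[OF u l] z, of n] by (simp add: bloch_norm_def add_increasing)
    qed
    have "(\<lambda>n. (1 - (norm z)\<^sup>2) * norm (deriv (u n) z - deriv l z)) \<longlonglongrightarrow>
        (1 - (norm z)\<^sup>2) * norm (0 - deriv l z)"
      by (intro tendsto_intros deriv z)
    from tendsto_le[OF _ dist this] le show ?thesis by simp
  qed
  ultimately have "bloch_norm l = 0"
    using bloch_if_weight_le(2)[of l 0] l bloch_norm_nonneg[OF l] by (simp add: bloch_def)
  from bloch_norm_eq_0D[OF l this] dist show ?thesis by simp
qed

text \<open>
If the quotient stays above \<open>\<epsilon>\<close> along points \<open>z n\<close> with \<open>norm (\<phi> (z n))\<close> tending to 1, then the test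
functions centred at \<open>\<phi> (z n)\<close> are bounded in \<open>A\<^sup>p\<close> and tend to zero pointwise with their derivatives, so by
compactness a subsequence of their images is null in the Bloch norm. Evaluating the weight at \<open>z n\<close>
shows that these norms stay above a multiple of \<open>\<epsilon>\<close>.
\<close>

lemma compact_imp_vanishes:
  assumes \<phi>: "analytic_self_map \<phi>" and p: "0 < p"
    and compact: "compact_operator (bergman p) (bergman_norm p) bloch_topology (comp_op \<phi>)"
  shows "vanishes_at_boundary_values \<phi>
      (\<lambda>z. (1 - (norm z)\<^sup>2) * norm (deriv \<phi> z) / (1 - (norm (\<phi> z))\<^sup>2) powr (1 + 2 / p))"
    (is "vanishes_at_boundary_values \<phi> ?F")
proof (rule ccontr)
  interpret Bl: Metric_space bloch bloch_dist by (rule bloch_metric_space)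
  assume "\<not> vanishes_at_boundary_values \<phi> ?F"
  then obtain \<epsilon> where \<epsilon>: "0 < \<epsilon>"
    and far: "\<And>\<delta>. 0 < \<delta> \<Longrightarrow> \<delta> < 1 \<Longrightarrow> \<exists>z\<in>unit_disc. \<delta> < norm (\<phi> z) \<and> norm (\<phi> z) < 1 \<and> \<epsilon> \<le> \<bar>?F z\<bar>"
    unfolding vanishes_at_boundary_values_def by (meson not_less)
  \<comment> \<open>The shift by 2 keeps the centres outside the disc of radius \<open>1 / 2\<close>, as the test functions require.\<close>
  have "\<exists>z\<in>unit_disc. 1 - 1 / real (n + 2) < norm (\<phi> z) \<and> norm (\<phi> z) < 1 \<and> \<epsilon> \<le> \<bar>?F z\<bar>" for n
    by (rule far) (auto simp: field_simps)
  then obtain z where z: "\<And>n. z n \<in> unit_disc" "\<And>n. 1 - 1 / real (n + 2) < norm (\<phi> (z n))"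
      "\<And>n. norm (\<phi> (z n)) < 1" "\<And>n. \<epsilon> \<le> \<bar>?F (z n)\<bar>"
    by metis
  define a where "a n = \<phi> (z n)" for n
  have a1: "norm (a n) < 1" for n using z(3) by (simp add: a_def)
  have a2: "1 / 2 \<le> norm (a n)" for n
  proof -
    have "1 / real (n + 2) \<le> 1 / 2" by (simp add: field_simps)
    then show ?thesis using z(2)[of n] unfolding a_def by linarith
  qed
  have a_lim: "(\<lambda>n. norm (a n)) \<longlonglongrightarrow> 1"
  proof (rule tendsto_sandwich)
    show "(\<lambda>n. 1 - 1 / real (n + 2)) \<longlonglongrightarrow> 1" by real_asymp
    show "\<forall>\<^sub>F n in sequentially. 1 - 1 / real (n + 2) \<le> norm (a n)"
      using z(2) by (auto simp: a_def intro!: always_eventually less_imp_le)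
    show "\<forall>\<^sub>F n in sequentially. norm (a n) \<le> 1"
      using a1 by (auto intro!: always_eventually less_imp_le)
  qed simp
  obtain k :: nat where "3 / p < k" using reals_Archimedean2 by blast
  then have k: "3 \<le> k * p" "0 < k - 2 / p" "0 < k"
    using p by (auto simp: field_simps intro: gr0I)
  define f where "f n = bergman_test p k (a n)" for n
  have f: "f n \<in> bergman p" "bergman_norm p (f n) \<le> 32 powr (1 / p)" for n
    unfolding f_def using bergman_test_bergman[OF a2 a1 p k(1)] by auto
  define S where "S = comp_op \<phi> ` range f"
  have "norm_bounded (bergman p) (bergman_norm p) (range f)"
    unfolding norm_bounded_def using f by blast
  then have S: "S \<subseteq> bloch" and "compactin Bl.mtopology (Bl.mtopology closure_of S)"
    using compact unfolding compact_operator_def S_def topspace_bloch_topology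
    by (auto simp: bloch_topology_def)
  moreover have "S \<subseteq> Bl.mtopology closure_of S"
    using S by (intro closure_of_subset) simp
  then have "range (\<lambda>n. comp_op \<phi> (f n)) \<subseteq> Bl.mtopology closure_of S"
    unfolding S_def by blast
  ultimately obtain l r where r: "strict_mono (r :: nat \<Rightarrow> nat)"
    and "limitin Bl.mtopology ((\<lambda>n. comp_op \<phi> (f n)) \<circ> r) l sequentially"
    unfolding Bl.compactin_sequentially by blast
  then have lim: "limitin bloch_topology (\<lambda>n. comp_op \<phi> (f (r n))) l sequentially"
    by (simp add: bloch_topology_def comp_def)
  have u: "comp_op \<phi> (f n) \<in> bloch" for n using S unfolding S_def by blast
  have small: "(\<lambda>n. f (r n) w) \<longlonglongrightarrow> 0" "(\<lambda>n. deriv (f (r n)) w) \<longlonglongrightarrow> 0" if "w \<in> unit_disc" for w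
    using bergman_test_tendsto_0[of "\<lambda>n. a (r n)" k p w] a1 k(2) that
      LIMSEQ_subseq_LIMSEQ[OF a_lim r] by (simp_all add: f_def comp_def)
  have "(\<lambda>n. bloch_norm (comp_op \<phi> (f (r n)))) \<longlonglongrightarrow> 0"
  proof (rule bloch_norm_tendsto_0_if_pointwise[OF lim u])
    show "(\<lambda>n. comp_op \<phi> (f (r n)) 0) \<longlonglongrightarrow> 0"
      using small(1)[OF analytic_self_map_in_disc[OF \<phi>, of 0]] by (simp add: comp_op_def)
    fix w assume w: "w \<in> unit_disc"
    have "(\<lambda>n. norm (deriv (f (r n)) (\<phi> w)) * norm (deriv \<phi> w)) \<longlonglongrightarrow> 0"
      by (intro tendsto_mult_left_zero tendsto_norm_zero small analytic_self_map_in_disc[OF \<phi> w])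
    then have "(\<lambda>n. norm (deriv (comp_op \<phi> (f (r n))) w)) \<longlonglongrightarrow> 0"
      by (simp add: norm_deriv_comp_op[OF \<phi> bergman_analytic[OF f(1)] w])
    then show "(\<lambda>n. deriv (comp_op \<phi> (f (r n))) w) \<longlonglongrightarrow> 0"
      by (rule tendsto_norm_zero_cancel)
  qed
  moreover have "\<epsilon> * (1 / 2 ^ (k + 2)) \<le> bloch_norm (comp_op \<phi> (f n))" for n
  proof -
    have nonneg: "0 \<le> 1 - (norm (z n))\<^sup>2" by (rule unit_disc_weight_nonneg[OF z(1)])
    then have "\<epsilon> \<le> ?F (z n)" using z(4)[of n] by simp
    then have "\<epsilon> * (1 / 2 ^ (k + 2)) \<le> ?F (z n) * (1 / 2 ^ (k + 2))"
      by (intro mult_right_mono) auto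
    also have "\<dots> = (1 - (norm (z n))\<^sup>2) * norm (deriv \<phi> (z n)) *
        (1 / 2 ^ (k + 2) / (1 - (norm (a n))\<^sup>2) powr (1 + 2 / p))"
      by (simp add: a_def)
    also have "\<dots> \<le> (1 - (norm (z n))\<^sup>2) * norm (deriv \<phi> (z n)) * norm (deriv (f n) (a n))"
      unfolding f_def using nonneg
      by (intro mult_left_mono norm_deriv_bergman_test_centre_ge a1 a2 p k) auto
    also have "\<dots> = (1 - (norm (z n))\<^sup>2) * norm (deriv (comp_op \<phi> (f n)) (z n))"
      by (simp add: norm_deriv_comp_op[OF \<phi> bergman_analytic[OF f(1)] z(1)] a_def)
    also have "\<dots> \<le> bloch_norm (comp_op \<phi> (f n))"
      using bloch_weight_le[OF u z(1)] by (simp add: bloch_norm_def add_increasing)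
    finally show ?thesis .
  qed
  ultimately have "\<epsilon> * (1 / 2 ^ (k + 2)) \<le> 0"
    by (intro tendsto_lowerbound[where F = sequentially]) auto
  moreover have "0 < \<epsilon> * (1 / 2 ^ (k + 2))" using \<epsilon> by simp
  ultimately show False by linarith
qed

theorem corollary3p8:
  fixes \<phi> :: "complex \<Rightarrow> complex" and p :: real
  assumes "analytic_self_map \<phi>"
    and "0 < p"
    and "bounded_operator (bergman p) (bergman_norm p) bloch bloch_norm (comp_op \<phi>)"
  shows "compact_operator (bergman p) (bergman_norm p) bloch_topology (comp_op \<phi>) \<longleftrightarrow>
    vanishes_at_boundary_values \<phi>
      (\<lambda>z. (1 - (norm z)\<^sup>2) * norm (deriv \<phi> z) / (1 - (norm (\<phi> z))\<^sup>2) powr (1 + 2 / p))"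
proof -
  have "comp_op \<phi> ` bergman p \<subseteq> bloch"
    using assms(3) by (simp add: bounded_operator_def)
  then show ?thesis
    using compact_imp_vanishes[OF assms(1,2)] vanishes_imp_compact[OF assms(1,2)] by blast
qed

end
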